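(* Let $\mathbb K$ be a field. If $F\in\mathbb K\langle x,y\rangle$ is a homogeneous potential of degree $3$, then the potential algebra $A_F=\mathbb K\langle x,y\rangle/\mathrm{Id}(\partial_xF,\partial_yF)$ is infinite dimensional over $\mathbb K$.
   Context: $\mathbb K\langle x,y\rangle$ is the free associative unital algebra on $x,y$, with $\deg x=\deg y=1$. A potential is a polynomial $F\in\mathbb K\langle x,y\rangle$ that is cyclicly invariant, i.e. fixed by the linear map sending each monomial $zu$ ($z\in\{x,y\}$, $u$ a monomial) to $uz$ and fixing constants. The linear maps $\partial_x,\partial_y:\mathbb K\langle x,y\rangle\to\mathbb K\langle x,y\rangle$ are defined on monomials by $\partial_x w=u$ if $w=xu$ and $\partial_x w=0$ otherwise; $\partial_y w=u$ if $w=yu$ and $\partial_y w=0$ otherwise. $\mathrm{Id}(\cdot)$ denotes the two-sided ideal generated by the given elements. *)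

theory Defs
  imports "HOL-Library.Poly_Mapping" "HOL-Algebra.Algebraic_Closure_Type"
begin

text \<open>Words form the free monoid under concatenation. It is written additively because
  \<^type>\<open>poly_mapping\<close> takes its exponents in a \<^class>\<open>monoid_add\<close>; its product is then
  the convolution product of the monoid algebra, here the free associative algebra.\<close>

instantiation list :: (type) monoid_add
begin

definition zero_list :: "'a list" where "zero_list = []"

definition plus_list :: "'a list \<Rightarrow> 'a list \<Rightarrow> 'a list" where "plus_list u v = u @ v"

instance by standard (simp_all add: zero_list_def plus_list_def)

end

datatype gen = GenX | GenY

type_synonym 'k free_alg = "gen list \<Rightarrow>\<^sub>0 'k"

definition scalar :: "'k::field \<Rightarrow> 'k free_alg"
  where "scalar c = Poly_Mapping.single [] c"

definition monomial :: "gen list \<Rightarrow> 'k::field free_alg"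
  where "monomial w = Poly_Mapping.single w 1"

text \<open>The linear map with prescribed values on the basis of monomials.\<close>

definition linear_ext :: "(gen list \<Rightarrow> 'k::field free_alg) \<Rightarrow> 'k free_alg \<Rightarrow> 'k free_alg"
  where "linear_ext g F =
    (\<Sum>w\<in>Poly_Mapping.keys F. scalar (Poly_Mapping.lookup F w) * g w)"

text \<open>\<^term>\<open>rotate1\<close> sends \<open>z # u\<close> to \<open>u @ [z]\<close> and fixes the empty word.\<close>

definition cyclic_shift :: "'k::field free_alg \<Rightarrow> 'k free_alg"
  where "cyclic_shift = linear_ext (\<lambda>w. monomial (rotate1 w))"

definition potential :: "'k::field free_alg \<Rightarrow> bool"
  where "potential F \<longleftrightarrow> cyclic_shift F = F"

text \<open>With this convention \<open>0\<close> is homogeneous of every degree.\<close>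

definition homogeneous :: "nat \<Rightarrow> 'k::field free_alg \<Rightarrow> bool"
  where "homogeneous n F \<longleftrightarrow> (\<forall>w\<in>Poly_Mapping.keys F. length w = n)"

definition partial_deriv :: "gen \<Rightarrow> 'k::field free_alg \<Rightarrow> 'k free_alg"
  where "partial_deriv z = linear_ext
    (\<lambda>w. case w of [] \<Rightarrow> 0 | z' # u \<Rightarrow> if z' = z then monomial u else 0)"

definition relations_ideal :: "'k::field free_alg \<Rightarrow> 'k free_alg set"
  where "relations_ideal F =
    Idl\<^bsub>ring_of_type_algebra\<^esub> {partial_deriv GenX F, partial_deriv GenY F}"

definition potential_algebra :: "'k::field free_alg \<Rightarrow> 'k free_alg set ring"
  where "potential_algebra F = ring_of_type_algebra Quot relations_ideal F"

text \<open>The image of the ground field in the quotient: multiplication by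
  its elements is the scalar multiplication of the quotient algebra.\<close>

definition potential_algebra_scalars :: "'k::field free_alg \<Rightarrow> 'k free_alg set set"
  where "potential_algebra_scalars F =
    range (\<lambda>c. relations_ideal F +>\<^bsub>ring_of_type_algebra\<^esub> scalar c)"

lemma ring_free_alg: "ring (ring_of_type_algebra :: 'k::field free_alg ring)"
proof -
  have "\<exists>y. x + y = 0" "\<exists>y. y + x = 0" for x :: "'k free_alg"
    using add.right_inverse add.left_inverse by blast+
  then show ?thesis
    unfolding ring_of_type_algebra_def
    by unfold_locales (auto simp: algebra_simps Units_def)
qed

lemma ideal_relations_ideal: "ideal (relations_ideal F) ring_of_type_algebra"
  unfolding relations_ideal_def
  by (rule ring.genideal_ideal[OF ring_free_alg]) (simp add: ring_of_type_algebra_def)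

lemma ring_potential_algebra: "ring (potential_algebra F)"
  unfolding potential_algebra_def by (rule ideal.quotient_is_ring[OF ideal_relations_ideal])

lemma subfield_potential_algebra_scalars:
  fixes F :: "'k::field free_alg"
  assumes "\<one>\<^bsub>potential_algebra F\<^esub> \<noteq> \<zero>\<^bsub>potential_algebra F\<^esub>"
  shows "subfield (potential_algebra_scalars F) (potential_algebra F)"
proof -
  let ?K = "ring_of_type_algebra :: 'k ring"
  let ?R = "ring_of_type_algebra :: 'k free_alg ring"
  let ?h = "\<lambda>c. relations_ideal F +>\<^bsub>?R\<^esub> scalar c"
  have K: "field ?K" by (rule field_from_type_algebra)
  have "scalar \<in> ring_hom ?K ?R"
    by (auto simp: ring_hom_def ring_of_type_algebra_def scalar_def Poly_Mapping.single_add
        Poly_Mapping.mult_single Poly_Mapping.single_one[symmetric] zero_list_def plus_list_def)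
  moreover have "(+>\<^bsub>?R\<^esub>) (relations_ideal F) \<in> ring_hom ?R (potential_algebra F)"
    unfolding potential_algebra_def by (rule ideal.rcos_ring_hom[OF ideal_relations_ideal])
  ultimately have "?h \<in> ring_hom ?K (potential_algebra F)"
    using ring_hom_trans[of scalar ?K ?R "(+>\<^bsub>?R\<^esub>) (relations_ideal F)"] by (simp add: comp_def)
  then have h: "ring_hom_ring ?K (potential_algebra F) ?h"
    by (intro ring_hom_ringI2 ring_potential_algebra cring.axioms(1)
        domain.axioms(1) field.axioms(1) K)
  have "subfield (?h ` carrier ?K) (potential_algebra F)"
    by (rule ring_hom_ring.img_is_subfield(2)[OF h field.carrier_is_subfield[OF K] assms])
  then show ?thesis
    by (simp add: potential_algebra_scalars_def ring_of_type_algebra_def)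
qed

end

theory Submission
  imports Defs "HOL-Library.Product_Plus"
begin

text \<open>
  Cyclic invariance forces \<open>F = a x\<^sup>3 + b (xxy + xyx + yxx) + c (xyy + yxy + yyx) + d y\<^sup>3\<close>, so
  the relations are \<open>a x\<^sup>2 + b (xy + yx) + c y\<^sup>2\<close> and \<open>b x\<^sup>2 + c (xy + yx) + d y\<^sup>2\<close>: two
  vectors in the three-dimensional span of \<open>x\<^sup>2\<close>, \<open>xy + yx\<close> and \<open>y\<^sup>2\<close>. Hence some nonzero linear
  functional on that span, with values \<open>p\<close>, \<open>q\<close>, \<open>r\<close> on the three basis vectors, kills both of
  them (\<open>exists_common_orthogonal\<close>). The stronger relations \<open>x\<^sup>2 = p t\<close>, \<open>xy + yx = q t\<close>,
  \<open>y\<^sup>2 = r t\<close> with \<open>t\<close> central define the Clifford algebra over \<open>K[t]\<close> of a binary quadratic form,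
  which is free over \<open>K[t]\<close> with basis \<open>1, x, y, xy\<close>. It is a quotient of the potential algebra,
  and it contains all powers of a nonzero multiple of \<open>t\<close>.

  The Clifford algebra enters through its left regular module \<open>K[t]\<^sup>4\<close>: the free algebra
  acts on it (\<open>act_mult\<close>), the relations act as zero (\<open>act_partial_deriv_cubic_potential\<close>), and
  one of \<open>x\<^sup>2\<close>, \<open>xy + yx\<close>, \<open>y\<^sup>2\<close> acts as a nonzero multiple of \<open>t\<close>. The first coordinate of the
  image of \<open>1\<close> is then a linear map from the potential algebra to \<open>K[t]\<close> of unbounded degree,
  which a finite-dimensional space does not admit (\<open>infinite_dimension_if_unbounded_degree\<close>).
  No step divides by an integer or needs a root, so the argument covers every field.
\<close>

section \<open>Linear maps of unbounded degree\<close>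

lemma coset_eq_imp_linear_eq:
  fixes \<phi> :: "'k::field free_alg \<Rightarrow> 'b::ab_group_add"
  assumes add: "\<And>f g. \<phi> (f + g) = \<phi> f + \<phi> g"
    and ideal: "\<And>f. f \<in> relations_ideal F \<Longrightarrow> \<phi> f = 0"
    and eq: "relations_ideal F +>\<^bsub>ring_of_type_algebra\<^esub> f =
      relations_ideal F +>\<^bsub>ring_of_type_algebra\<^esub> g"
  shows "\<phi> f = \<phi> g"
proof -
  interpret I: ideal "relations_ideal F" ring_of_type_algebra
    by (rule ideal_relations_ideal)
  have "f \<in> relations_ideal F +>\<^bsub>ring_of_type_algebra\<^esub> f"
    by (rule I.a_rcos_self) (simp add: ring_of_type_algebra_def)
  then obtain i where "i \<in> relations_ideal F" "f = i + g"
    unfolding eq by (auto simp: a_r_coset_def' ring_of_type_algebra_def)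
  then show ?thesis
    by (simp add: add ideal)
qed

text \<open>A finite-dimensional space is built from \<open>0\<close> by adjoining one vector at a time. Adjoining
  the class of \<open>g\<close> replaces a bound \<open>N\<close> on the degrees of the values of \<open>\<phi>\<close> by at most
  \<open>max (degree (\<phi> g)) N\<close>, so the degrees stay bounded. Working with representatives in
  the free algebra avoids the map induced on cosets.\<close>

lemma infinite_dimension_if_unbounded_degree:
  fixes F :: "'k::field free_alg" and \<phi> :: "'k free_alg \<Rightarrow> 'k poly"
  assumes add: "\<And>f g. \<phi> (f + g) = \<phi> f + \<phi> g"
    and scal: "\<And>c f. \<phi> (scalar c * f) = smult c (\<phi> f)"
    and ideal: "\<And>f. f \<in> relations_ideal F \<Longrightarrow> \<phi> f = 0"
    and unbounded: "\<And>N. \<exists>f. degree (\<phi> f) > N"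
  shows "ring.infinite_dimension (potential_algebra F)
    (potential_algebra_scalars F) (carrier (potential_algebra F))"
proof -
  interpret A: ring "potential_algebra F"
    by (rule ring_potential_algebra)
  define \<pi> where "\<pi> f = relations_ideal F +>\<^bsub>ring_of_type_algebra\<^esub> f" for f
  have hom: "\<pi> \<in> ring_hom ring_of_type_algebra (potential_algebra F)"
    unfolding \<pi>_def potential_algebra_def by (rule ideal.rcos_ring_hom[OF ideal_relations_ideal])
  have \<pi>_add: "\<pi> f \<oplus>\<^bsub>potential_algebra F\<^esub> \<pi> g = \<pi> (f + g)" for f g
    using ring_hom_add[OF hom, of f g] by (simp add: ring_of_type_algebra_def)
  have \<pi>_mult: "\<pi> f \<otimes>\<^bsub>potential_algebra F\<^esub> \<pi> g = \<pi> (f * g)" for f g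
    using ring_hom_mult[OF hom, of f g] by (simp add: ring_of_type_algebra_def)
  have surj: "carrier (potential_algebra F) = range \<pi>"
    unfolding potential_algebra_def FactRing_def A_RCOSETS_def' \<pi>_def
    by (auto simp: ring_of_type_algebra_def)
  have \<pi>_eq: "\<phi> f = \<phi> g" if "\<pi> f = \<pi> g" for f g
    by (rule coset_eq_imp_linear_eq[of \<phi>, OF add ideal that[unfolded \<pi>_def]])
  have \<phi>_zero: "\<phi> 0 = 0" using scal[of 0 0] by simp
  have zero: "\<zero>\<^bsub>potential_algebra F\<^esub> = \<pi> 0"
    using ring_hom_zero[OF hom ring_free_alg ring_potential_algebra]
    by (simp add: ring_of_type_algebra_def)
  \<comment> \<open>The inclusion in the carrier is carried along so that every vector has a representative.\<close>
  have bounded: "E \<subseteq> carrier (potential_algebra F) \<and> (\<exists>N. \<forall>f. \<pi> f \<in> E \<longrightarrow> degree (\<phi> f) \<le> N)"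
    if "A.dimension n K E" "K = potential_algebra_scalars F" for n K E
    using that
  proof (induction rule: A.dimension.induct)
    case (zero_dim K)
    have "degree (\<phi> f) = 0" if "\<pi> f = \<zero>\<^bsub>potential_algebra F\<^esub>" for f
      using \<pi>_eq[of f 0] that by (simp add: zero \<phi>_zero)
    then show ?case by simp
  next
    case (Suc_dim v E n K)
    then obtain N where E: "E \<subseteq> carrier (potential_algebra F)"
      and N: "\<And>f. \<pi> f \<in> E \<Longrightarrow> degree (\<phi> f) \<le> N" by blast
    obtain g where g: "v = \<pi> g" using Suc_dim.hyps surj by blast
    have ext: "\<exists>c h. \<pi> h \<in> E \<and> u = \<pi> (scalar c * g + h)"
      if "u \<in> A.line_extension K v E" for u
    proof -
      obtain k e where ke: "k \<in> K" "e \<in> E" "u = k \<otimes>\<^bsub>potential_algebra F\<^esub> v \<oplus>\<^bsub>potential_algebra F\<^esub> e"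
        using \<open>u \<in> _\<close> unfolding A.line_extension_mem_iff by blast
      obtain c where "k = \<pi> (scalar c)"
        using ke(1) Suc_dim.prems by (auto simp: potential_algebra_scalars_def \<pi>_def)
      moreover obtain h where "e = \<pi> h" using ke(2) E surj by blast
      ultimately show ?thesis using ke g by (auto simp: \<pi>_add \<pi>_mult)
    qed
    have "degree (\<phi> f) \<le> max (degree (\<phi> g)) N" if f: "\<pi> f \<in> A.line_extension K v E" for f
    proof -
      obtain c h where h: "\<pi> h \<in> E" "\<pi> f = \<pi> (scalar c * g + h)"
        using ext[OF f] by blast
      have "\<phi> f = smult c (\<phi> g) + \<phi> h"
        using \<pi>_eq[OF h(2)] by (simp add: add scal)
      then show ?thesis
        using N[OF h(1)] degree_smult_le[of c "\<phi> g"]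
          degree_add_le_max[of "smult c (\<phi> g)" "\<phi> h"]
        by simp
    qed
    moreover have "A.line_extension K v E \<subseteq> carrier (potential_algebra F)"
      using ext surj by blast
    ultimately show ?case by blast
  qed
  show ?thesis
  proof
    assume "A.finite_dimension (potential_algebra_scalars F) (carrier (potential_algebra F))"
    then obtain n where
      "A.dimension n (potential_algebra_scalars F) (carrier (potential_algebra F))"
      unfolding A.finite_dimension_def by blast
    from bounded[OF this refl] obtain N where "\<And>f. degree (\<phi> f) \<le> N"
      using surj by blast
    then show False using unbounded[of N] by (meson not_le)
  qed
qed

section \<open>The regular module of a rank-two Clifford algebra\<close>

type_synonym 'k quad = "'k poly \<times> 'k poly \<times> 'k poly \<times> 'k poly"

fun scale :: "'k::field poly \<Rightarrow> 'k quad \<Rightarrow> 'k quad"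
  where "scale h (a, b, c, d) = (h * a, h * b, h * c, h * d)"

text \<open>Left multiplication by \<open>x\<close> and \<open>y\<close> on \<open>a + b x + c y + d xy\<close> in the algebra over \<open>K[t]\<close> with
  \<open>x\<^sup>2 = P\<close>, \<open>xy + yx = Q\<close>, \<open>y\<^sup>2 = R\<close>; for instance \<open>y x = Q - xy\<close> and
  \<open>y xy = (Q - xy) y = Q y - R x\<close>.\<close>

fun clifford_op :: "'k::field poly \<Rightarrow> 'k poly \<Rightarrow> 'k poly \<Rightarrow> gen \<Rightarrow> 'k quad \<Rightarrow> 'k quad"
  where
    "clifford_op P Q R GenX (a, b, c, d) = (P * b, a, P * d, c)"
  | "clifford_op P Q R GenY (a, b, c, d) = (Q * b + R * c, - (R * d), a + Q * d, - b)"

definition word_op :: "'k::field poly \<Rightarrow> 'k poly \<Rightarrow> 'k poly \<Rightarrow> gen list \<Rightarrow> 'k quad \<Rightarrow> 'k quad"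
  where "word_op P Q R w = foldr (clifford_op P Q R) w"

definition act :: "'k::field poly \<Rightarrow> 'k poly \<Rightarrow> 'k poly \<Rightarrow> 'k free_alg \<Rightarrow> 'k quad \<Rightarrow> 'k quad"
  where "act P Q R f v =
    (\<Sum>w\<in>Poly_Mapping.keys f. scale [:Poly_Mapping.lookup f w:] (word_op P Q R w v))"

lemma scale_add_right: "scale h (u + v) = scale h u + scale h v"
  by (cases u; cases v) (simp add: algebra_simps)

lemma scale_add_left: "scale (g + h) v = scale g v + scale h v"
  by (cases v) (simp add: algebra_simps)

lemma scale_scale: "scale g (scale h v) = scale (g * h) v"
  by (cases v) (simp add: mult.assoc)

lemma scale_zero [simp]: "scale 0 v = 0" "scale h 0 = 0"
  by (cases v, simp add: zero_prod_def) (simp add: zero_prod_def)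

lemma scale_one [simp]: "scale 1 v = v"
  by (cases v) simp

lemma clifford_op_add: "clifford_op P Q R z (u + v) = clifford_op P Q R z u + clifford_op P Q R z v"
  by (cases z; cases u; cases v) (simp_all add: algebra_simps)

lemma clifford_op_scale: "clifford_op P Q R z (scale h v) = scale h (clifford_op P Q R z v)"
  by (cases z; cases v) (simp_all add: algebra_simps)

lemma word_op_add: "word_op P Q R w (u + v) = word_op P Q R w u + word_op P Q R w v"
  by (induction w) (simp_all add: word_op_def clifford_op_add)

lemma word_op_scale: "word_op P Q R w (scale h v) = scale h (word_op P Q R w v)"
  by (induction w) (simp_all add: word_op_def clifford_op_scale)

lemma word_op_append: "word_op P Q R (u @ w) v = word_op P Q R u (word_op P Q R w v)"
  by (simp add: word_op_def)

lemma clifford_relations: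
  "word_op P Q R [GenX, GenX] v = scale P v"
  "word_op P Q R [GenX, GenY] v + word_op P Q R [GenY, GenX] v = scale Q v"
  "word_op P Q R [GenY, GenY] v = scale R v"
  by (cases v; simp add: word_op_def algebra_simps)+

lemma act_superset:
  assumes "finite S" "Poly_Mapping.keys f \<subseteq> S"
  shows "act P Q R f v =
    (\<Sum>w\<in>S. scale [:Poly_Mapping.lookup f w:] (word_op P Q R w v))"
  unfolding act_def
  by (rule sum.mono_neutral_left) (use assms in \<open>auto simp: in_keys_iff\<close>)

lemma act_add: "act P Q R (f + g) v = act P Q R f v + act P Q R g v"
proof -
  let ?S = "Poly_Mapping.keys f \<union> Poly_Mapping.keys g"
  have "Poly_Mapping.keys (f + g) \<subseteq> ?S" by (rule keys_add)
  moreover have "[:a + b:] = [:a:] + [:b:]" for a b :: 'a by simp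
  ultimately show ?thesis
    by (simp only: act_superset[of ?S] lookup_add sum.distrib scale_add_left
        finite_Un finite_keys Un_upper1 Un_upper2)
qed

lemma act_single: "act P Q R (Poly_Mapping.single w c) v = scale [:c:] (word_op P Q R w v)"
  by (subst act_superset[of "{w}"]) auto

lemma act_zero [simp]: "act P Q R 0 v = 0"
  by (simp add: act_def)

lemma act_add_right: "act P Q R f (u + v) = act P Q R f u + act P Q R f v"
  by (simp add: act_def word_op_add scale_add_right sum.distrib)

lemma act_scale: "act P Q R f (scale h v) = scale h (act P Q R f v)"
proof -
  have "scale h (sum m S) = (\<Sum>w\<in>S. scale h (m w))" for m :: "gen list \<Rightarrow> 'a quad" and S
    by (induction S rule: infinite_finite_induct) (simp_all add: scale_add_right)
  then show ?thesis by (simp add: act_def word_op_scale scale_scale mult.commute)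
qed

lemma free_alg_induct [case_names zero single add]:
  fixes f :: "'k::field free_alg"
  assumes "P 0" "\<And>w c. P (Poly_Mapping.single w c)" "\<And>f g. P f \<Longrightarrow> P g \<Longrightarrow> P (f + g)"
  shows "P f"
proof (induction f rule: update_induct)
  case const
  then show ?case by (rule assms(1))
next
  case (update f k c)
  have "Poly_Mapping.update k c f = f + Poly_Mapping.single k c"
    using update.hyps
    by (intro poly_mapping_eqI)
       (auto simp: lookup_update lookup_add lookup_single in_keys_iff when_def)
  then show ?case using assms update by simp
qed

text \<open>Both sides are additive in \<open>f\<close> and in \<open>g\<close>, which leaves words, where a concatenation acts as
  the composite of the two operators.\<close>

lemma act_mult: "act P Q R (f * g) v = act P Q R f (act P Q R g v)"
proof (induction f rule: free_alg_induct)
  case (single w c)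
  show ?case
  proof (induction g rule: free_alg_induct)
    case (single u d)
    show ?case
      by (simp add: mult_single act_single plus_list_def word_op_append word_op_scale scale_scale
          mult.commute)
  next
    case (add f g)
    then show ?case by (simp add: distrib_left act_add act_add_right)
  qed (simp add: act_single word_op_scale[where h = 0, simplified])
qed (simp_all add: distrib_right act_add)

lemma act_scalar_mult: "act P Q R (scalar c * f) v = scale [:c:] (act P Q R f v)"
  by (simp add: act_mult scalar_def act_single word_op_def)

lemma act_zero_right [simp]: "act P Q R f 0 = 0"
  using act_scale[of P Q R f 0 0] by simp

lemma act_power:
  assumes "\<And>v. act P Q R f v = scale h v"
  shows "act P Q R (f ^ n) v = scale (h ^ n) v"
proof (induction n)
  case 0
  have "(1 :: 'a free_alg) = Poly_Mapping.single [] 1"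
    by (simp flip: single_one add: zero_list_def)
  then have "act P Q R 1 v = scale [:1:] (word_op P Q R [] v)"
    using act_single[of P Q R "[]" 1 v] by simp
  then show ?case by (simp add: word_op_def flip: one_pCons)
next
  case (Suc n)
  then show ?case by (simp add: act_mult assms scale_scale)
qed

text \<open>The elements acting as zero form a two-sided ideal, the annihilator of the module.\<close>

lemma relations_ideal_act_zero:
  assumes "\<And>z v. act P Q R (partial_deriv z F) v = 0" and "f \<in> relations_ideal F"
  shows "act P Q R f v = 0"
proof -
  let ?R = "ring_of_type_algebra :: 'a free_alg ring"
  interpret ring ?R by (rule ring_free_alg)
  let ?J = "{f. \<forall>v. act P Q R f v = 0}"
  have neg: "act P Q R (- f) v = - act P Q R f v" for f v
    using act_add[of P Q R f "- f" v] by (simp add: eq_neg_iff_add_eq_0 add.commute)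
  have "ideal ?J ?R"
  proof (rule idealI)
    show "subgroup ?J (add_monoid ?R)"
    proof (rule add.subgroupI)
      fix a assume a: "a \<in> ?J"
      have "\<ominus>\<^bsub>?R\<^esub> a = - a"
        by (rule minus_equality) (simp_all add: ring_of_type_algebra_def)
      then show "\<ominus>\<^bsub>?R\<^esub> a \<in> ?J" using a by (simp add: neg)
    qed (auto simp: ring_of_type_algebra_def act_add intro: exI[of _ 0])
  qed (use ring_free_alg in \<open>simp_all add: ring_of_type_algebra_def act_mult del: split_paired_All\<close>)
  then have "relations_ideal F \<subseteq> ?J"
    unfolding relations_ideal_def by (rule genideal_minimal) (use assms(1) in auto)
  then show ?thesis using assms(2) by blast
qed

section \<open>The relations of a cubic potential\<close>

lemma lookup_scalar_mult: "Poly_Mapping.lookup (scalar c * f) w = c * Poly_Mapping.lookup f w"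
  by (simp add: scalar_def map.rep_eq when_def flip: zero_list_def mult_map_scale_conv_mult)

lemma lookup_linear_ext:
  "Poly_Mapping.lookup (linear_ext g F) u =
    (\<Sum>w\<in>Poly_Mapping.keys F. Poly_Mapping.lookup F w * Poly_Mapping.lookup (g w) u)"
  by (simp add: linear_ext_def lookup_sum lookup_scalar_mult)

text \<open>\<^const>\<open>rotate1\<close> is injective, so no word other than \<open>w\<close> contributes to this coefficient.\<close>

lemma lookup_cyclic_shift:
  "Poly_Mapping.lookup (cyclic_shift F) (rotate1 w) = Poly_Mapping.lookup F w"
proof -
  have "inj (rotate1 :: gen list \<Rightarrow> gen list)" by (rule inj_rotate1)
  then show ?thesis
    by (simp add: cyclic_shift_def lookup_linear_ext monomial_def lookup_single inj_eq when_def
        if_distrib[of "(*) _"] in_keys_iff cong: if_cong)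
qed

lemma lookup_partial_deriv:
  fixes F :: "'a::field free_alg"
  shows
  "Poly_Mapping.lookup (partial_deriv z F) u = Poly_Mapping.lookup F (z # u)"
proof -
  have "Poly_Mapping.lookup (case w of [] \<Rightarrow> 0 | z' # u \<Rightarrow> if z' = z then monomial u else 0) u =
      ((1 :: 'a) when w = z # u)" for w
    by (auto simp: monomial_def lookup_single when_def split: list.split)
  then show ?thesis
    by (simp only: partial_deriv_def lookup_linear_ext)
       (simp add: when_def if_distrib[of "(*) _"] in_keys_iff cong: if_cong)
qed

lemma potential_lookup_rotate1:
  assumes "potential F"
  shows "Poly_Mapping.lookup F (rotate1 w) = Poly_Mapping.lookup F w"
  using assms lookup_cyclic_shift[of F w] by (simp add: potential_def)

text \<open>Cyclic invariance gives \<open>zxy\<close> and \<open>zyx\<close> the same coefficient in \<open>F\<close>. So \<open>xy\<close> and \<open>yx\<close> occur in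
  each relation only through \<open>xy + yx\<close>, which the module turns into the scalar \<open>Q\<close>.\<close>

lemma act_partial_deriv_cubic_potential:
  assumes "potential F" "homogeneous 3 F"
  shows "act P Q R (partial_deriv z F) v =
    scale ([:Poly_Mapping.lookup F [z, GenX, GenX]:] * P
      + [:Poly_Mapping.lookup F [z, GenX, GenY]:] * Q
      + [:Poly_Mapping.lookup F [z, GenY, GenY]:] * R) v"
proof -
  let ?S = "{[GenX, GenX], [GenX, GenY], [GenY, GenX], [GenY, GenY]}"
  have "u \<in> ?S" if "u \<in> Poly_Mapping.keys (partial_deriv z F)" for u
  proof -
    have "length (z # u) = 3"
      using that assms(2) unfolding homogeneous_def
      by (metis in_keys_iff lookup_partial_deriv)
    then obtain a b where "u = [a, b]"
      by (auto simp: numeral_eq_Suc length_Suc_conv)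
    then show ?thesis by (cases a; cases b) auto
  qed
  then have S: "Poly_Mapping.keys (partial_deriv z F) \<subseteq> ?S" by blast
  note rot = potential_lookup_rotate1[OF assms(1)]
  have "Poly_Mapping.lookup F [z, GenY, GenX] = Poly_Mapping.lookup F [z, GenX, GenY]"
    using rot[of "[GenX, GenX, GenY]"] rot[of "[GenX, GenY, GenX]"]
      rot[of "[GenX, GenY, GenY]"] rot[of "[GenY, GenY, GenX]"] rot[of "[GenY, GenX, GenY]"]
    by (cases z) simp_all
  then have "act P Q R (partial_deriv z F) v =
      scale [:Poly_Mapping.lookup F [z, GenX, GenX]:] (word_op P Q R [GenX, GenX] v)
      + scale [:Poly_Mapping.lookup F [z, GenX, GenY]:]
          (word_op P Q R [GenX, GenY] v + word_op P Q R [GenY, GenX] v)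
      + scale [:Poly_Mapping.lookup F [z, GenY, GenY]:] (word_op P Q R [GenY, GenY] v)"
    by (subst act_superset[OF _ S])
       (simp_all add: lookup_partial_deriv scale_add_right add.assoc)
  then show ?thesis
    by (simp only: clifford_relations scale_scale scale_add_left)
qed

text \<open>The cross product of \<open>(a, b, c)\<close> and \<open>(b, c, d)\<close> is orthogonal to both. If it vanishes, the
  two vectors are proportional, and a nonzero vector is needed that is orthogonal to a nonzero
  one of them: \<open>(b, - a, 0)\<close> or \<open>(0, c, - b)\<close> if \<open>(a, b, c)\<close> is nonzero, and \<open>(1, 0, 0)\<close> otherwise.\<close>

lemma exists_common_orthogonal:
  fixes a b c d :: "'k::field"
  shows "\<exists>p q r. (p \<noteq> 0 \<or> q \<noteq> 0 \<or> r \<noteq> 0) \<and>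
    a * p + b * q + c * r = 0 \<and> b * p + c * q + d * r = 0"
proof (cases "b * d - c * c = 0 \<and> b * c - a * d = 0 \<and> a * c - b * b = 0")
  case False
  have "a * (b * d - c * c) + b * (b * c - a * d) + c * (a * c - b * b) = 0"
    "b * (b * d - c * c) + c * (b * c - a * d) + d * (a * c - b * b) = 0"
    by (simp_all add: algebra_simps)
  with False show ?thesis by blast
next
  case True
  consider "a = 0" "b = 0" "c = 0" | "b \<noteq> 0 \<or> - a \<noteq> 0" | "c \<noteq> 0" by auto
  then show ?thesis
  proof cases
    case 1
    then have "a * 1 + b * 0 + c * 0 = 0" "b * 1 + c * 0 + d * 0 = 0" by simp_all
    then show ?thesis using one_neq_zero by blast
  next
    case 2
    have "a * b + b * (- a) + c * 0 = 0" by simp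
    moreover have "b * b + c * (- a) + d * 0 = 0" using True by (simp add: mult.commute[of c a])
    ultimately show ?thesis using 2 by blast
  next
    case 3
    have "a * 0 + b * c + c * (- b) = 0" by simp
    moreover have "b * 0 + c * c + d * (- b) = 0" using True by (simp add: mult.commute[of d b])
    ultimately show ?thesis using 3 by blast
  qed
qed

theorem theorem3p1:
  fixes F :: "'k::field free_alg"
  assumes "potential F" and "homogeneous 3 F"
  shows "ring.infinite_dimension (potential_algebra F)
    (potential_algebra_scalars F) (carrier (potential_algebra F))"
proof -
  let ?c = "Poly_Mapping.lookup F"
  obtain p q r where nz: "p \<noteq> 0 \<or> q \<noteq> 0 \<or> r \<noteq> 0"
    and X: "?c [GenX, GenX, GenX] * p + ?c [GenX, GenX, GenY] * q + ?c [GenX, GenY, GenY] * r = 0"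
    and Y: "?c [GenX, GenX, GenY] * p + ?c [GenX, GenY, GenY] * q + ?c [GenY, GenY, GenY] * r = 0"
    using exists_common_orthogonal by metis
  define P where "P = [:0, p:]"
  define Q where "Q = [:0, q:]"
  define R where "R = [:0, r:]"
  note rot = potential_lookup_rotate1[OF assms(1)]
  have "?c [GenY, GenX, GenX] = ?c [GenX, GenX, GenY]" "?c [GenY, GenX, GenY] = ?c [GenX, GenY, GenY]"
    using rot[of "[GenY, GenX, GenX]"] rot[of "[GenY, GenX, GenY]"]
      rot[of "[GenX, GenY, GenY]"] rot[of "[GenY, GenY, GenX]"]
    by simp_all
  with X Y have rel: "act P Q R (partial_deriv z F) v = 0" for z v
    by (cases z)
       (simp_all add: act_partial_deriv_cubic_potential[OF assms] P_def Q_def R_def mult.commute)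
  define \<phi> where "\<phi> f = fst (act P Q R f (1, 0, 0, 0))" for f
  \<comment> \<open>A multiple of \<open>t\<close> comes from whichever of \<open>p\<close>, \<open>q\<close>, \<open>r\<close> is nonzero.\<close>
  obtain f c where c: "c \<noteq> 0" and f: "\<And>v. act P Q R f v = scale [:0, c:] v"
  proof -
    have mon: "act P Q R (monomial w) v = word_op P Q R w v" for w v
      by (simp add: monomial_def act_single flip: one_pCons)
    consider "p \<noteq> 0" | "q \<noteq> 0" | "r \<noteq> 0" using nz by blast
    then show thesis
    proof cases
      case 1
      show thesis by (rule that[OF 1, of "monomial [GenX, GenX]"])
          (simp add: mon clifford_relations flip: P_def)
    next
      case 2
      show thesis by (rule that[OF 2, of "monomial [GenX, GenY] + monomial [GenY, GenX]"])
          (simp add: mon act_add clifford_relations flip: Q_def)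
    next
      case 3
      show thesis by (rule that[OF 3, of "monomial [GenY, GenY]"])
          (simp add: mon clifford_relations flip: R_def)
    qed
  qed
  show ?thesis
  proof (rule infinite_dimension_if_unbounded_degree[of \<phi>])
    show "\<phi> (f + g) = \<phi> f + \<phi> g" for f g by (simp add: \<phi>_def act_add)
    show "\<phi> (scalar c * f) = smult c (\<phi> f)" for c f
      by (cases "act P Q R f (1, 0, 0, 0)") (simp add: \<phi>_def act_scalar_mult)
    show "\<phi> f = 0" if "f \<in> relations_ideal F" for f
      using relations_ideal_act_zero[OF rel that] by (simp add: \<phi>_def)
    fix N
    have "degree (\<phi> (f ^ Suc N)) = Suc N"
      using c by (simp add: \<phi>_def act_power[OF f] degree_power_eq del: power_Suc)
    then show "\<exists>f. degree (\<phi> f) > N" by (metis lessI)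
  qed
qed

end
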